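(* Let $\frac12\le H<\frac34$ and let $u$ be the mild solution of the one-dimensional stochastic wave equation with zero initial conditions driven by the fractional-white noise $W^H$ (fractional in time with Hurst parameter $H$, white in space). Then for every fixed $x\in\mathbb R$ and all $t\ge s\ge 0$, $$\frac{4}{H}\,\mathbb E[u(t,x)u(s,x)]=\frac{1}{H(2H+1)}\left(t^{2H+1}+s^{2H+1}\right)-\frac{2}{2H}\,t\,(t-s)^{2H}+\frac{2}{2H+1}(t-s)^{2H+1}.$$
   Context: The equation is $\partial_t^2u=\partial_x^2u+\dot W^H$ for $t\ge0$, $x\in\mathbb R$, with $u(0,x)=0$ and $\partial_tu(0,x)=0$. The noise $W^H$ is centred Gaussian, fractional in time with Hurst parameter $H$ and white in space: the Wiener integrals of deterministic functions $f,g$ on $[0,\infty)\times\mathbb R$ are jointly centred Gaussian with $$\mathbb E\Big[\int f\,dW^H\int g\,dW^H\Big]=H(2H-1)\int_0^\infty\!\int_0^\infty\!\int_{\mathbb R}f(r,y)g(v,y)|r-v|^{2H-2}\,dy\,dv\,dr\quad\text{if } H>\tfrac12,$$ and $=\int_0^\infty\int_{\mathbb R}f(r,y)g(r,y)\,dy\,dr$ if $H=\frac12$. The mild solution is the centred Gaussian field $u(t,x)=\int_0^t\int_{\mathbb R}G_1(t-r,x-y)\,W^H(dr,dy)$ with $G_1(t,x)=\frac12\mathbf 1_{\{|x|<t\}}$. *)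

theory Defs
  imports "HOL-Probability.Probability"
begin

text \<open>Point masses at 0 count as (degenerate) centred Gaussian laws.\<close>

definition centred_gaussian :: "'w measure \<Rightarrow> ('w \<Rightarrow> real) \<Rightarrow> bool" where
  "centred_gaussian M X \<longleftrightarrow> X \<in> borel_measurable M \<and>
     ((AE \<omega> in M. X \<omega> = 0) \<or> (\<exists>\<sigma>>0. distributed M lborel X (normal_density 0 \<sigma>)))"

definition jointly_centred_gaussian ::
    "'w measure \<Rightarrow> 'i set \<Rightarrow> ('i \<Rightarrow> 'w \<Rightarrow> real) \<Rightarrow> bool" where
  "jointly_centred_gaussian M I X \<longleftrightarrow>
     (\<forall>F c. finite F \<and> F \<subseteq> I \<longrightarrow> centred_gaussian M (\<lambda>\<omega>. \<Sum>i\<in>F. c i * X i \<omega>))"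

text \<open>
  A function on \<open>[0,\<infinity>) \<times> \<real>\<close> is represented by a function on \<open>\<real> \<times> \<real>\<close> (time first, space second)
  of which only the values at nonnegative times are used.
\<close>

definition noise_cov :: "real \<Rightarrow> (real \<times> real \<Rightarrow> real) \<Rightarrow> (real \<times> real \<Rightarrow> real) \<Rightarrow> real" where
  "noise_cov H f g =
     (if H = 1/2
      then LBINT r:{0..}. LBINT y. f (r, y) * g (r, y)
      else H * (2 * H - 1) *
        (LBINT r:{0..}. LBINT v:{0..}. LBINT y. f (r, y) * g (v, y) * \<bar>r - v\<bar> powr (2 * H - 2)))"

text \<open>
  The deterministic integrands: those for which the integral defining the variance converges
  absolutely. By positive definiteness of the kernel, \<^term>\<open>noise_cov H f g\<close> then converges
  absolutely for any two of them.
\<close>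

definition wiener_integrands :: "real \<Rightarrow> (real \<times> real \<Rightarrow> real) set" where
  "wiener_integrands H = {f. set_borel_measurable borel ({0..} \<times> UNIV) f \<and>
     (if H = 1/2
      then (\<integral>\<^sup>+r\<in>{0..}. (\<integral>\<^sup>+y. ennreal ((f (r, y))\<^sup>2) \<partial>lborel) \<partial>lborel) < \<infinity>
      else (\<integral>\<^sup>+r\<in>{0..}. (\<integral>\<^sup>+v\<in>{0..}. (\<integral>\<^sup>+y.
              ennreal (\<bar>f (r, y)\<bar> * \<bar>f (v, y)\<bar> * \<bar>r - v\<bar> powr (2 * H - 2))
              \<partial>lborel) \<partial>lborel) \<partial>lborel) < \<infinity>)}"

text \<open>The noise is given by its Wiener integral: \<open>W f\<close> is the random variable \<open>\<integral> f dW\<^sup>H\<close>.\<close>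

locale fractional_white_noise = prob_space M
  for M :: "'w measure" and H :: real and W :: "(real \<times> real \<Rightarrow> real) \<Rightarrow> 'w \<Rightarrow> real" +
  assumes hurst: "1/2 \<le> H" "H < 1"
    and gaussian: "jointly_centred_gaussian M (wiener_integrands H) W"
    and covariance: "f \<in> wiener_integrands H \<Longrightarrow> g \<in> wiener_integrands H \<Longrightarrow>
           expectation (\<lambda>\<omega>. W f \<omega> * W g \<omega>) = noise_cov H f g"

definition wave_kernel :: "real \<Rightarrow> real \<Rightarrow> real" where
  "wave_kernel t x = 1/2 * indicator {x. \<bar>x\<bar> < t} x"

text \<open>Wiener integrals are only determined almost surely, hence so is the mild solution.\<close>

definition mild_solution ::
    "'w measure \<Rightarrow> ((real \<times> real \<Rightarrow> real) \<Rightarrow> 'w \<Rightarrow> real) \<Rightarrow> (real \<Rightarrow> real \<Rightarrow> 'w \<Rightarrow> real) \<Rightarrow> bool" where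
  "mild_solution M W u \<longleftrightarrow> (\<forall>t\<ge>0. \<forall>x. u t x \<in> borel_measurable M \<and>
     (AE \<omega> in M. u t x \<omega> = W (\<lambda>(r, y). indicator {0..t} r * wave_kernel (t - r) (x - y)) \<omega>))"

end

theory Submission
  imports Defs
begin

text \<open>
  All integrands are nonnegative, so by Tonelli the spatial integral can be taken last. At distance
  \<open>z = \<bar>x - y\<bar>\<close> from \<open>x\<close>, the kernel restricts the time integrals to \<open>[0, t - z)\<close> and \<open>[0, s - z)\<close>,
  where they give \<open>1/4\<close> of the fractional Brownian covariance of the times \<open>t - z\<close> and \<open>s - z\<close>, that is,
  \<open>1/8 ((t - z)\<^sup>2\<^sup>H + (s - z)\<^sup>2\<^sup>H - (t - s)\<^sup>2\<^sup>H)\<close>; integrating over \<open>0 \<le> z \<le> s\<close> and doubling,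
  for the two sides of \<open>x\<close>, yields the formula. The case \<open>s = t\<close> shows that the kernel is an admissible integrand.
\<close>

section \<open>From nonnegative integrals to iterated Bochner integrals\<close>

text \<open>Order swaps and evaluations are done with nonnegative integrals, where Tonelli needs no
  integrability; this carries the value over to the Bochner integrals of \<open>noise_cov\<close>. A
  finite value makes \<open>f\<close> integrable on the product, so Fubini applies.\<close>

lemma iterated_integral_eq_nn_integral:
  fixes f :: "'a \<Rightarrow> 'b \<Rightarrow> real"
  assumes "sigma_finite_measure M1" "sigma_finite_measure M2"
    and meas: "case_prod f \<in> borel_measurable (M1 \<Otimes>\<^sub>M M2)"
    and nonneg: "\<And>x y. 0 \<le> f x y"
    and nn: "(\<integral>\<^sup>+x. \<integral>\<^sup>+y. ennreal (f x y) \<partial>M2 \<partial>M1) = ennreal c" and c: "0 \<le> c"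
  shows "(\<integral>x. \<integral>y. f x y \<partial>M2 \<partial>M1) = c"
proof -
  interpret M1: sigma_finite_measure M1 by fact
  interpret M2: sigma_finite_measure M2 by fact
  interpret pair_sigma_finite M1 M2 ..
  have nn2: "(\<integral>\<^sup>+z. ennreal (case_prod f z) \<partial>(M1 \<Otimes>\<^sub>M M2)) = ennreal c"
    using M2.nn_integral_fst[of "\<lambda>z. ennreal (case_prod f z)" M1] meas nn by simp
  have int: "integrable (M1 \<Otimes>\<^sub>M M2) (case_prod f)"
    using nn2 nonneg by (intro integrableI_nonneg meas) (auto simp: less_top)
  have "(\<integral>x. \<integral>y. f x y \<partial>M2 \<partial>M1) = (\<integral>z. case_prod f z \<partial>(M1 \<Otimes>\<^sub>M M2))"
    using integral_fst[OF int] .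
  also have "\<dots> = c"
    using nn2 nonneg c by (subst integral_eq_nn_integral) (auto intro: meas)
  finally show ?thesis .
qed

section \<open>One-dimensional integrals in time and space\<close>

text \<open>For \<open>a < 1\<close> the integrand is unbounded at \<open>r = v\<close>. Splitting
  there suffices: on each side the antiderivative is continuous up to \<open>v\<close>, as
  \<open>a > 0\<close>, and the derivative is required only in the open interval.\<close>

lemma nn_integral_abs_diff_powr:
  fixes a p v :: real
  assumes a: "0 < a" and v: "0 \<le> v" "v \<le> p"
  shows "(\<integral>\<^sup>+r. ennreal (indicator {0..<p} r * \<bar>r - v\<bar> powr (a - 1)) \<partial>lborel)
           = ennreal ((v powr a + (p - v) powr a) / a)"
proof -
  have 1: "((\<lambda>r. \<bar>r - v\<bar> powr (a - 1)) has_integral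
      (- ((v - v) powr a / a) - - ((v - 0) powr a / a))) {0..v}"
  proof (rule fundamental_theorem_of_calculus_interior)
    show "continuous_on {0..v} (\<lambda>r. - ((v - r) powr a / a))"
      using a by (intro continuous_intros continuous_on_powr') auto
    show "((\<lambda>r. - ((v - r) powr a / a)) has_vector_derivative \<bar>r - v\<bar> powr (a - 1)) (at r)"
      if "r \<in> {0<..<v}" for r
      using that a unfolding has_real_derivative_iff_has_vector_derivative[symmetric]
      by (auto intro!: derivative_eq_intros simp: abs_if)
  qed (use v in auto)
  have 2: "((\<lambda>r. \<bar>r - v\<bar> powr (a - 1)) has_integral
      ((p - v) powr a / a - (v - v) powr a / a)) {v..p}"
  proof (rule fundamental_theorem_of_calculus_interior)
    show "continuous_on {v..p} (\<lambda>r. (r - v) powr a / a)"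
      using a by (intro continuous_intros continuous_on_powr') auto
    show "((\<lambda>r. (r - v) powr a / a) has_vector_derivative \<bar>r - v\<bar> powr (a - 1)) (at r)"
      if "r \<in> {v<..<p}" for r
      using that a unfolding has_real_derivative_iff_has_vector_derivative[symmetric]
      by (auto intro!: derivative_eq_intros simp: abs_if)
  qed (use v in auto)
  have "((\<lambda>r. \<bar>r - v\<bar> powr (a - 1)) has_integral (v powr a + (p - v) powr a) / a) {0..p}"
    using has_integral_combine[OF v 1 2] a by (simp add: add_divide_distrib)
  then have "(\<integral>\<^sup>+r. ennreal (indicator {0..p} r * \<bar>r - v\<bar> powr (a - 1)) \<partial>lborel)
      = ennreal ((v powr a + (p - v) powr a) / a)"
    by (intro nn_integral_has_integral_lebesgue) auto
  moreover have "(\<integral>\<^sup>+r. ennreal (indicator {0..<p} r * \<bar>r - v\<bar> powr (a - 1)) \<partial>lborel)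
      = (\<integral>\<^sup>+r. ennreal (indicator {0..p} r * \<bar>r - v\<bar> powr (a - 1)) \<partial>lborel)"
    by (rule nn_integral_cong_AE, rule AE_mp[OF AE_lborel_singleton[of p]], rule AE_I2)
       (auto simp: indicator_def)
  ultimately show ?thesis by simp
qed

text \<open>Up to the factor \<open>H (2 H - 1)\<close>, where \<open>a = 2 H - 1\<close>, the covariance of fractional Brownian motion.\<close>

lemma nn_integral_fbm_cov:
  fixes a p q :: real
  assumes a: "0 < a" and q: "0 \<le> q" "q \<le> p"
  shows "(\<integral>\<^sup>+v. \<integral>\<^sup>+r. ennreal (indicator {0..<q} v * (indicator {0..<p} r * \<bar>r - v\<bar> powr (a - 1))) \<partial>lborel \<partial>lborel)
           = ennreal ((p powr (a + 1) + q powr (a + 1) - (p - q) powr (a + 1)) / (a * (a + 1)))"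
proof -
  \<comment> \<open>The inner integral is known for \<open>v <= p\<close>, which
    \<open>v < q\<close> ensures. Discarding the null point \<open>v = q\<close> closes the
    interval, as the fundamental theorem of calculus wants it.\<close>
  have "(\<integral>\<^sup>+v. \<integral>\<^sup>+r. ennreal (indicator {0..<q} v * (indicator {0..<p} r * \<bar>r - v\<bar> powr (a - 1))) \<partial>lborel \<partial>lborel)
      = (\<integral>\<^sup>+v. ennreal (indicator {0..q} v * ((v powr a + (p - v) powr a) / a)) \<partial>lborel)"
  proof (rule nn_integral_cong_AE, rule AE_mp[OF AE_lborel_singleton[of q]], intro AE_I2 impI)
    fix v assume "v \<noteq> q"
    then show "(\<integral>\<^sup>+r. ennreal (indicator {0..<q} v * (indicator {0..<p} r * \<bar>r - v\<bar> powr (a - 1))) \<partial>lborel)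
        = ennreal (indicator {0..q} v * ((v powr a + (p - v) powr a) / a))"
      using nn_integral_abs_diff_powr[OF a, of v p] q
      by (cases "v \<in> {0..<q}") (auto simp: indicator_def)
  qed
  also have "\<dots> = ennreal ((p powr (a + 1) + q powr (a + 1) - (p - q) powr (a + 1)) / (a * (a + 1)))"
  proof (rule nn_integral_has_integral_lebesgue)
    show "0 \<le> (v powr a + (p - v) powr a) / a" for v using a by simp
    have k: "0 < a + a * a" using a by (simp add: add_pos_pos)
    define P where "P v = (v powr (a + 1) - (p - v) powr (a + 1)) / (a * (a + 1))" for v
    have "((\<lambda>v. (v powr a + (p - v) powr a) / a) has_integral P q - P 0) {0..q}"
    proof (rule fundamental_theorem_of_calculus_interior)
      show "continuous_on {0..q} P"
        using a q unfolding P_def by (intro continuous_intros continuous_on_powr') auto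
      show "(P has_vector_derivative (v powr a + (p - v) powr a) / a) (at v)"
        if "v \<in> {0<..<q}" for v
        using that a q k unfolding has_real_derivative_iff_has_vector_derivative[symmetric] P_def
        by (auto intro!: derivative_eq_intros) (simp add: field_simps)
    qed (use q in auto)
    also have "P q - P 0 = (p powr (a + 1) + q powr (a + 1) - (p - q) powr (a + 1)) / (a * (a + 1))"
      using a by (simp add: P_def diff_divide_distrib add_divide_distrib)
    finally show "((\<lambda>v. (v powr a + (p - v) powr a) / a) has_integral
        (p powr (a + 1) + q powr (a + 1) - (p - q) powr (a + 1)) / (a * (a + 1))) {0..q}" .
  qed
  finally show ?thesis .
qed

text \<open>Splitting at the kink \<open>y = x\<close> leaves two mirror images, each contributing
  \<open>F s - F 0\<close>.\<close>

lemma has_integral_abs_diff: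
  fixes F f :: "real \<Rightarrow> real" and x s :: real
  assumes s: "0 \<le> s" and cont: "continuous_on {0..s} F"
    and der: "\<And>z. z \<in> {0<..<s} \<Longrightarrow> (F has_real_derivative f z) (at z)"
  shows "((\<lambda>y. f \<bar>x - y\<bar>) has_integral 2 * (F s - F 0)) {x - s..x + s}"
proof -
  have 1: "((\<lambda>y. f \<bar>x - y\<bar>) has_integral (- F (x - x)) - (- F (x - (x - s)))) {x - s..x}"
  proof (rule fundamental_theorem_of_calculus_interior)
    show "continuous_on {x - s..x} (\<lambda>y. - F (x - y))"
      by (intro continuous_intros continuous_on_compose2[OF cont]) auto
    show "((\<lambda>y. - F (x - y)) has_vector_derivative f \<bar>x - y\<bar>) (at y)"
      if "y \<in> {x - s<..<x}" for y
      using that unfolding has_real_derivative_iff_has_vector_derivative[symmetric]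
      by (auto intro!: derivative_eq_intros DERIV_chain2[OF der])
  qed (use s in auto)
  have 2: "((\<lambda>y. f \<bar>x - y\<bar>) has_integral F ((x + s) - x) - F (x - x)) {x..x + s}"
  proof (rule fundamental_theorem_of_calculus_interior)
    show "continuous_on {x..x + s} (\<lambda>y. F (y - x))"
      by (intro continuous_intros continuous_on_compose2[OF cont]) auto
    show "((\<lambda>y. F (y - x)) has_vector_derivative f \<bar>x - y\<bar>) (at y)"
      if "y \<in> {x<..<x + s}" for y
      using that der[of "y - x"] DERIV_shift[of F "f (y - x)" y "- x"]
      unfolding has_real_derivative_iff_has_vector_derivative[symmetric]
      by (simp add: abs_minus_commute[of x])
  qed (use s in auto)
  show ?thesis
    using has_integral_combine[OF _ _ 1 2] s by simp
qed

section \<open>The kernel as an integrand\<close>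

text \<open>Literally the integrand in \<open>mild_solution\<close>: half the indicator of the
  backward light cone of \<open>(t, x)\<close>, cut off at time 0.\<close>

definition wave_integrand :: "real \<Rightarrow> real \<Rightarrow> real \<times> real \<Rightarrow> real" where
  "wave_integrand t x = (\<lambda>(r, y). indicator {0..t} r * wave_kernel (t - r) (x - y))"

text \<open>The cone condition \<open>\<bar>x - y\<bar> < t - r\<close> is solved for
  \<open>r\<close>; it already implies \<open>r <= t\<close>.\<close>

lemma wave_integrand_eq:
  "wave_integrand t x (r, y) = 1/2 * indicator {0..<t - \<bar>x - y\<bar>} r"
  by (auto simp: wave_integrand_def wave_kernel_def indicator_def)

lemma wave_integrand_nonneg: "0 \<le> wave_integrand t x z"
  by (cases z) (simp add: wave_integrand_eq)

lemma borel_measurable_wave_integrand [measurable]: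
  "wave_integrand t x \<in> borel_measurable (borel \<Otimes>\<^sub>M borel)"
proof -
  have "wave_integrand t x = (\<lambda>z. if 0 \<le> fst z \<and> fst z < t - \<bar>x - snd z\<bar> then 1/2 else 0)"
    by (auto simp: wave_integrand_eq indicator_def fun_eq_iff)
  also have "\<dots> \<in> borel_measurable (borel \<Otimes>\<^sub>M borel)" by measurable
  finally show ?thesis .
qed

section \<open>Covariance integrals of two kernels\<close>

text \<open>Meant for \<open>a = 2 * H - 1\<close>; \<open>C\<close> is the covariance without the
  factor \<open>H * (2 * H - 1)\<close>. The sign of \<open>C\<close> is recorded because
  \<open>ennreal\<close> sends negative reals to 0.\<close>

lemma nn_integral_wave_cov:
  fixes a s t x :: real
  assumes a: "0 < a" and st: "0 \<le> s" "s \<le> t"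
  defines "C \<equiv> 1/2 * ((t powr (a + 2) + s powr (a + 2) - (t - s) powr (a + 2)) / (a + 2)
      - s * (t - s) powr (a + 1)) / (a * (a + 1))"
  shows "(\<integral>\<^sup>+r. \<integral>\<^sup>+v. \<integral>\<^sup>+y. ennreal (wave_integrand t x (r, y) * wave_integrand s x (v, y) *
            \<bar>r - v\<bar> powr (a - 1)) \<partial>lborel \<partial>lborel \<partial>lborel) = ennreal C"
    and "0 \<le> C"
proof -
  define h where "h r v y = ennreal (wave_integrand t x (r, y) * wave_integrand s x (v, y) *
      \<bar>r - v\<bar> powr (a - 1))" for r v y
  \<comment> \<open>Arbitrary measurable arguments make this rule serve every order of the three
    variables below.\<close>
  have h_meas [measurable]: "(\<lambda>z. h (f z) (g z) (k z)) \<in> borel_measurable N"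
    if [measurable]: "f \<in> borel_measurable N" "g \<in> borel_measurable N" "k \<in> borel_measurable N"
    for f g k and N :: "'n measure"
    unfolding h_def by measurable
  \<comment> \<open>\<open>R z\<close> is the double time integral for \<open>p = t - z\<close> and
    \<open>q = s - z\<close>, so that \<open>p - q = t - s\<close> is free of \<open>z\<close>;
    \<open>P\<close> is an antiderivative of \<open>R\<close>.\<close>
  define R where "R z = ((t - z) powr (a + 1) + (s - z) powr (a + 1) - (t - s) powr (a + 1)) / (a * (a + 1))" for z
  define P where "P z = (- ((t - z) powr (a + 2) + (s - z) powr (a + 2)) / (a + 2)
      - z * (t - s) powr (a + 1)) / (a * (a + 1))" for z
  have R_nonneg: "0 \<le> R z" if "z \<le> s" for z
    using that st a powr_mono2[of "a + 1" "t - s" "t - z"] unfolding R_def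
    by (intro divide_nonneg_nonneg) (auto simp: add_increasing2)
  \<comment> \<open>Three swaps bring \<open>y\<close> outermost and \<open>r\<close>, which has the
    longer range, innermost, as in \<open>nn_integral_fbm_cov\<close>.\<close>
  have "(\<integral>\<^sup>+r. \<integral>\<^sup>+v. \<integral>\<^sup>+y. h r v y \<partial>lborel \<partial>lborel \<partial>lborel)
      = (\<integral>\<^sup>+r. \<integral>\<^sup>+y. \<integral>\<^sup>+v. h r v y \<partial>lborel \<partial>lborel \<partial>lborel)"
    by (intro nn_integral_cong lborel_pair.Fubini') measurable
  also have "\<dots> = (\<integral>\<^sup>+y. \<integral>\<^sup>+r. \<integral>\<^sup>+v. h r v y \<partial>lborel \<partial>lborel \<partial>lborel)"
    by (intro lborel_pair.Fubini') measurable
  also have "\<dots> = (\<integral>\<^sup>+y. \<integral>\<^sup>+v. \<integral>\<^sup>+r. h r v y \<partial>lborel \<partial>lborel \<partial>lborel)"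
    by (intro nn_integral_cong lborel_pair.Fubini') measurable
  also have "\<dots> = (\<integral>\<^sup>+y. ennreal (indicator {x - s..x + s} y * (1/4 * R \<bar>x - y\<bar>)) \<partial>lborel)"
  proof (intro nn_integral_cong)
    fix y :: real
    define p where "p = t - \<bar>x - y\<bar>"
    define q where "q = s - \<bar>x - y\<bar>"
    \<comment> \<open>The \<open>1/4\<close> is the product of the two kernel heights
      \<open>1/2\<close>.\<close>
    have h_eq: "h r v y = ennreal (1/4) *
        ennreal (indicator {0..<q} v * (indicator {0..<p} r * \<bar>r - v\<bar> powr (a - 1)))" for r v
      unfolding h_def wave_integrand_eq p_def[symmetric] q_def[symmetric]
      by (cases "r \<in> {0..<p}"; cases "v \<in> {0..<q}") (simp_all add: ennreal_mult'[symmetric])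
    show "(\<integral>\<^sup>+v. \<integral>\<^sup>+r. h r v y \<partial>lborel \<partial>lborel)
        = ennreal (indicator {x - s..x + s} y * (1/4 * R \<bar>x - y\<bar>))"
    \<comment> \<open>\<open>0 <= q\<close> means that \<open>y\<close> lies in
      \<open>{x - s..x + s}\<close>; otherwise the range of \<open>v\<close> is empty.\<close>
    proof (cases "0 \<le> q")
      case True
      have "(\<integral>\<^sup>+v. \<integral>\<^sup>+r. h r v y \<partial>lborel \<partial>lborel) = ennreal (1/4) *
          (\<integral>\<^sup>+v. \<integral>\<^sup>+r. ennreal (indicator {0..<q} v * (indicator {0..<p} r * \<bar>r - v\<bar> powr (a - 1))) \<partial>lborel \<partial>lborel)"
        by (simp add: h_eq nn_integral_cmult)
      also have "\<dots> = ennreal (1/4) * ennreal (R \<bar>x - y\<bar>)"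
        using True st by (subst nn_integral_fbm_cov[OF a]) (auto simp: p_def q_def R_def)
      finally show ?thesis
        using True by (auto simp: q_def indicator_def ennreal_mult'[symmetric])
    next
      case False
      then show ?thesis by (auto simp: h_eq q_def indicator_def)
    qed
  qed
  \<comment> \<open>The chain of equalities pauses here: \<open>PI\<close> and \<open>PC\<close>
    evaluate its last term.\<close>
  also have PI: "((\<lambda>y. 1/4 * R \<bar>x - y\<bar>) has_integral 1/4 * (2 * (P s - P 0))) {x - s..x + s}"
  proof (intro has_integral_mult_right has_integral_abs_diff)
    show "continuous_on {0..s} P"
      using a st unfolding P_def by (intro continuous_intros continuous_on_powr') auto
    show "(P has_real_derivative R z) (at z)" if "z \<in> {0<..<s}" for z
      using that a st unfolding P_def R_def
      by (auto intro!: derivative_eq_intros) (simp add: field_simps)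
  qed (use st in auto)
  have PC: "1/4 * (2 * (P s - P 0)) = C"
  proof -
    \<comment> \<open>Opaque letters keep the powers from being rewritten during the
      rearrangement.\<close>
    have alg: "1/4 * (2 * ((- D / c - E) / k - (- F / c) / k)) = 1/2 * ((F - D) / c - E) / k"
      for c k D E F :: real
      by (simp add: diff_divide_distrib add_divide_distrib)
    have "P s = (- ((t - s) powr (a + 2)) / (a + 2) - s * (t - s) powr (a + 1)) / (a * (a + 1))"
      "P 0 = (- (t powr (a + 2) + s powr (a + 2)) / (a + 2)) / (a * (a + 1))"
      by (simp_all add: P_def)
    then show ?thesis unfolding C_def by (simp only: alg)
  qed
  have "(\<integral>\<^sup>+y. ennreal (indicator {x - s..x + s} y * (1/4 * R \<bar>x - y\<bar>)) \<partial>lborel) = ennreal C"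
    using PI unfolding PC by (intro nn_integral_has_integral_lebesgue) (auto intro: R_nonneg)
  finally show "(\<integral>\<^sup>+r. \<integral>\<^sup>+v. \<integral>\<^sup>+y. ennreal (wave_integrand t x (r, y) * wave_integrand s x (v, y) *
            \<bar>r - v\<bar> powr (a - 1)) \<partial>lborel \<partial>lborel \<partial>lborel) = ennreal C"
    unfolding h_def .
  show "0 \<le> C"
    using has_integral_nonneg[OF PI] R_nonneg unfolding PC by (simp add: abs_le_iff)
qed

text \<open>Here the space integral comes first: at time \<open>r <= s\<close> the smaller cone lies
  inside the larger one, and its slice has length \<open>2 * (s - r)\<close> and weight
  \<open>1/4\<close>.\<close>

lemma nn_integral_wave_cov_white:
  fixes s t x :: real
  assumes st: "0 \<le> s" "s \<le> t"
  shows "(\<integral>\<^sup>+r. \<integral>\<^sup>+y. ennreal (wave_integrand t x (r, y) * wave_integrand s x (r, y)) \<partial>lborel \<partial>lborel)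
           = ennreal (s\<^sup>2 / 4)"
proof -
  have "(\<integral>\<^sup>+r. \<integral>\<^sup>+y. ennreal (wave_integrand t x (r, y) * wave_integrand s x (r, y)) \<partial>lborel \<partial>lborel)
      = (\<integral>\<^sup>+r. ennreal (indicator {0..s} r * (1/2 * (s - r))) \<partial>lborel)"
  proof (intro nn_integral_cong)
    fix r :: real
    have "(\<integral>\<^sup>+y. ennreal (wave_integrand t x (r, y) * wave_integrand s x (r, y)) \<partial>lborel)
        = (\<integral>\<^sup>+y. ennreal (1/4 * indicator {0..s} r) * indicator {x - (s - r)<..<x + (s - r)} y \<partial>lborel)"
    proof (intro nn_integral_cong)
      fix y :: real
      have "wave_integrand t x (r, y) * wave_integrand s x (r, y) = 1/4 * indicator {0..<s - \<bar>x - y\<bar>} r"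
        using st by (cases "r \<in> {0..<s - \<bar>x - y\<bar>}") (auto simp: wave_integrand_eq)
      \<comment> \<open>The cone is now read as an interval in \<open>y\<close> for fixed
        \<open>r\<close>, so that its length gives the integral.\<close>
      also have "r \<in> {0..<s - \<bar>x - y\<bar>} \<longleftrightarrow> r \<in> {0..s} \<and> y \<in> {x - (s - r)<..<x + (s - r)}"
        by auto
      then have "(indicator {0..<s - \<bar>x - y\<bar>} r :: real)
          = indicator {0..s} r * indicator {x - (s - r)<..<x + (s - r)} y"
        by (simp add: indicator_def)
      finally have eq: "wave_integrand t x (r, y) * wave_integrand s x (r, y)
          = 1/4 * (indicator {0..s} r * indicator {x - (s - r)<..<x + (s - r)} y)" .
      show "ennreal (wave_integrand t x (r, y) * wave_integrand s x (r, y))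
          = ennreal (1/4 * indicator {0..s} r) * indicator {x - (s - r)<..<x + (s - r)} y"
        unfolding eq by (cases "y \<in> {x - (s - r)<..<x + (s - r)}") simp_all
    qed
    also have "\<dots> = ennreal (1/4 * indicator {0..s} r) *
        emeasure lborel {x - (s - r)<..<x + (s - r)}"
      by (simp add: nn_integral_cmult_indicator)
    also have "\<dots> = ennreal (indicator {0..s} r * (1/2 * (s - r)))"
      by (cases "r \<in> {0..s}") (auto simp: ennreal_mult'[symmetric])
    finally show "(\<integral>\<^sup>+y. ennreal (wave_integrand t x (r, y) * wave_integrand s x (r, y)) \<partial>lborel)
        = ennreal (indicator {0..s} r * (1/2 * (s - r)))" .
  qed
  also have "\<dots> = ennreal (s\<^sup>2 / 4)"
  proof (rule nn_integral_has_integral_lebesgue)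
    have "((\<lambda>r. 1/2 * (s - r)) has_integral (s * s / 2 - s\<^sup>2 / 4) - (s * 0 / 2 - 0\<^sup>2 / 4)) {0..s}"
      using st unfolding power2_eq_square
      by (intro fundamental_theorem_of_calculus)
         (auto simp: has_real_derivative_iff_has_vector_derivative[symmetric] field_simps
               intro!: derivative_eq_intros)
    then show "((\<lambda>r. 1/2 * (s - r)) has_integral s\<^sup>2 / 4) {0..s}"
      by (simp add: power2_eq_square)
  qed auto
  finally show ?thesis .
qed

section \<open>Admissibility and the noise covariance\<close>

text \<open>This lets the restrictions of the time integrals to \<open>{0..}\<close> be
  dropped.\<close>

lemma wave_integrand_neg_time: "r < 0 \<Longrightarrow> wave_integrand t x (r, y) = 0"
  by (simp add: wave_integrand_eq)

lemma wave_integrand_in_wiener_integrands: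
  assumes "1/2 \<le> H" "0 \<le> t"
  shows "wave_integrand t x \<in> wiener_integrands H"
proof -
  have meas: "set_borel_measurable borel ({0..} \<times> UNIV) (wave_integrand t x)"
  proof -
    have "{0..} \<times> UNIV \<in> sets (borel :: (real \<times> real) measure)"
      by (intro borel_closed closed_Times) auto
    moreover have "wave_integrand t x \<in> borel_measurable borel"
      using borel_measurable_wave_integrand by (simp add: borel_prod)
    ultimately show ?thesis unfolding set_borel_measurable_def by measurable
  qed
  show ?thesis
  proof (cases "H = 1/2")
    case True
    have "(\<integral>\<^sup>+r\<in>{0..}. (\<integral>\<^sup>+y. ennreal ((wave_integrand t x (r, y))\<^sup>2) \<partial>lborel) \<partial>lborel)
        = (\<integral>\<^sup>+r. \<integral>\<^sup>+y. ennreal (wave_integrand t x (r, y) * wave_integrand t x (r, y)) \<partial>lborel \<partial>lborel)"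
      by (intro nn_integral_cong) (auto simp: indicator_def wave_integrand_neg_time power2_eq_square)
    then show ?thesis
      using True meas assms
      by (simp add: wiener_integrands_def nn_integral_wave_cov_white)
  next
    case False
    then have a: "0 < 2 * H - 1" using assms by simp
    have "(\<integral>\<^sup>+r\<in>{0..}. (\<integral>\<^sup>+v\<in>{0..}. (\<integral>\<^sup>+y. ennreal (\<bar>wave_integrand t x (r, y)\<bar> *
            \<bar>wave_integrand t x (v, y)\<bar> * \<bar>r - v\<bar> powr (2 * H - 2)) \<partial>lborel) \<partial>lborel) \<partial>lborel)
        = (\<integral>\<^sup>+r. \<integral>\<^sup>+v. \<integral>\<^sup>+y. ennreal (wave_integrand t x (r, y) * wave_integrand t x (v, y) *
            \<bar>r - v\<bar> powr ((2 * H - 1) - 1)) \<partial>lborel \<partial>lborel \<partial>lborel)"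
      (is "(\<integral>\<^sup>+r. ?F r * indicator {0..} r \<partial>lborel) = nn_integral lborel ?G")
    proof (intro nn_integral_cong)
      fix r :: real
      have "?F r = ?G r"
        by (intro nn_integral_cong)
           (auto simp: indicator_def wave_integrand_neg_time wave_integrand_nonneg)
      then show "?F r * indicator {0..} r = ?G r"
        by (auto simp: indicator_def wave_integrand_neg_time)
    qed
    then show ?thesis
      using False meas nn_integral_wave_cov(1)[OF a \<open>0 \<le> t\<close> order_refl, of x]
      by (simp add: wiener_integrands_def)
  qed
qed

lemma noise_cov_wave_integrand_white:
  assumes "0 \<le> s" "s \<le> t"
  shows "noise_cov (1/2) (wave_integrand t x) (wave_integrand s x) = s\<^sup>2 / 4"
proof -
  have "noise_cov (1/2) (wave_integrand t x) (wave_integrand s x)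
      = (LBINT r. LBINT y. wave_integrand t x (r, y) * wave_integrand s x (r, y))"
    unfolding noise_cov_def set_lebesgue_integral_def
    by (auto intro!: Bochner_Integration.integral_cong simp: indicator_def wave_integrand_neg_time)
  also have "\<dots> = s\<^sup>2 / 4"
    using nn_integral_wave_cov_white[OF assms]
    by (intro iterated_integral_eq_nn_integral)
       (auto simp: wave_integrand_nonneg lborel.sigma_finite_measure_axioms)
  finally show ?thesis .
qed

text \<open>The innermost integral is converted pointwise, at each \<open>(r, v)\<close>; the outer
  two are then handled by \<open>iterated_integral_eq_nn_integral\<close>.\<close>

lemma integral_wave_cov:
  fixes a s t x :: real
  assumes a: "0 < a" and st: "0 \<le> s" "s \<le> t"
  shows "(LBINT r. LBINT v. LBINT y. wave_integrand t x (r, y) * wave_integrand s x (v, y) *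
            \<bar>r - v\<bar> powr (a - 1)) =
    1/2 * ((t powr (a + 2) + s powr (a + 2) - (t - s) powr (a + 2)) / (a + 2)
      - s * (t - s) powr (a + 1)) / (a * (a + 1))"
    (is "_ = ?C")
proof -
  define g where "g r v y = wave_integrand t x (r, y) * wave_integrand s x (v, y) *
      \<bar>r - v\<bar> powr (a - 1)" for r v y
  have [measurable]: "(\<lambda>z. g (f z) (h z) (k z)) \<in> borel_measurable N"
    if [measurable]: "f \<in> borel_measurable N" "h \<in> borel_measurable N" "k \<in> borel_measurable N"
    for f h k and N :: "'n measure"
    unfolding g_def by measurable
  have g_nonneg: "0 \<le> g r v y" for r v y
    by (simp add: g_def wave_integrand_nonneg)
  \<comment> \<open>For fixed \<open>r\<close> and \<open>v\<close> the integrand is at most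
    \<open>1/4 * \<bar>r - v\<bar> powr (a - 1)\<close> and vanishes unless
    \<open>\<bar>x - y\<bar> < t - r\<close>.\<close>
  have g_int: "integrable lborel (g r v)" for r v
  proof (rule Bochner_Integration.integrable_bound)
    show "integrable lborel (\<lambda>y. (1/4 * \<bar>r - v\<bar> powr (a - 1)) * indicator {x - \<bar>t - r\<bar>..x + \<bar>t - r\<bar>} y :: real)"
      by (intro integrable_mult_right) auto
    show "AE y in lborel. norm (g r v y)
        \<le> norm ((1/4 * \<bar>r - v\<bar> powr (a - 1)) * indicator {x - \<bar>t - r\<bar>..x + \<bar>t - r\<bar>} y :: real)"
      by (auto simp: g_def wave_integrand_eq indicator_def)
  qed measurable
  have "(LBINT r. LBINT v. LBINT y. g r v y) = ?C"
  proof (rule iterated_integral_eq_nn_integral)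
    show "(\<integral>\<^sup>+r. \<integral>\<^sup>+v. ennreal (LBINT y. g r v y) \<partial>lborel \<partial>lborel) = ennreal ?C"
      using nn_integral_wave_cov(1)[OF assms, of x]
      unfolding g_def[symmetric] by (simp add: nn_integral_eq_integral g_int g_nonneg)
    show "0 \<le> ?C" by (rule nn_integral_wave_cov(2)[OF assms])
  qed (auto simp: g_nonneg lborel.sigma_finite_measure_axioms)
  then show ?thesis unfolding g_def .
qed

lemma noise_cov_wave_integrand:
  assumes "1/2 \<le> H" "0 \<le> s" "s \<le> t"
  shows "noise_cov H (wave_integrand t x) (wave_integrand s x) =
    1/4 * ((t powr (2 * H + 1) + s powr (2 * H + 1) - (t - s) powr (2 * H + 1)) / (2 * H + 1)
      - s * (t - s) powr (2 * H))"
proof (cases "H = 1/2")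
  case True
  \<comment> \<open>With \<open>2 * H = 1\<close> the bracket is \<open>t * s - s * (t - s)\<close>,
    that is, the square of \<open>s\<close>.\<close>
  show ?thesis
    unfolding True using assms noise_cov_wave_integrand_white[OF assms(2,3), of x]
    by (simp add: powr_numeral) (simp add: power2_eq_square algebra_simps)
next
  case False
  define a where "a = 2 * H - 1"
  have a: "0 < a" using False assms by (simp add: a_def)
  have "noise_cov H (wave_integrand t x) (wave_integrand s x)
      = H * a * (LBINT r:{0..}. LBINT v:{0..}. LBINT y. wave_integrand t x (r, y) * wave_integrand s x (v, y) *
            \<bar>r - v\<bar> powr (a - 1))"
    using False by (simp add: noise_cov_def a_def)
  also have "(LBINT r:{0..}. LBINT v:{0..}. LBINT y. wave_integrand t x (r, y) * wave_integrand s x (v, y) *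
            \<bar>r - v\<bar> powr (a - 1))
      = (LBINT r. LBINT v. LBINT y. wave_integrand t x (r, y) * wave_integrand s x (v, y) *
            \<bar>r - v\<bar> powr (a - 1))"
  proof -
    have 1: "indicator {0..} v *\<^sub>R (LBINT y. wave_integrand t x (r, y) * wave_integrand s x (v, y) * \<bar>r - v\<bar> powr (a - 1))
        = (LBINT y. wave_integrand t x (r, y) * wave_integrand s x (v, y) * \<bar>r - v\<bar> powr (a - 1))" for r v
      by (cases "0 \<le> v") (simp_all add: wave_integrand_neg_time)
    have 2: "indicator {0..} r *\<^sub>R (LBINT v. LBINT y. wave_integrand t x (r, y) * wave_integrand s x (v, y) * \<bar>r - v\<bar> powr (a - 1))
        = (LBINT v. LBINT y. wave_integrand t x (r, y) * wave_integrand s x (v, y) * \<bar>r - v\<bar> powr (a - 1))" for r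
      by (cases "0 \<le> r") (simp_all add: wave_integrand_neg_time)
    show ?thesis unfolding set_lebesgue_integral_def 1 2 ..
  qed
  also note integral_wave_cov[OF a assms(2,3)]
  \<comment> \<open>Since \<open>a + 1 = 2 * H\<close>, the prefactor \<open>H * a\<close> cancels
    \<open>a * (a + 1)\<close> up to \<open>1/2\<close>.\<close>
  also have "H * a * (1/2 * ((t powr (a + 2) + s powr (a + 2) - (t - s) powr (a + 2)) / (a + 2)
      - s * (t - s) powr (a + 1)) / (a * (a + 1)))
    = 1/4 * ((t powr (a + 2) + s powr (a + 2) - (t - s) powr (a + 2)) / (a + 2)
      - s * (t - s) powr (a + 1))"
  proof -
    have "a + 1 = 2 * H" "H \<noteq> 0" using assms by (simp_all add: a_def)
    then show ?thesis using a by simp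
  qed
  also have "a + 2 = 2 * H + 1" by (simp add: a_def)
  also have "a + 1 = 2 * H" by (simp add: a_def)
  finally show ?thesis .
qed

section \<open>The covariance of the solution\<close>

theorem theorem1:
  fixes M :: "'w measure" and H :: real
    and W :: "(real \<times> real \<Rightarrow> real) \<Rightarrow> 'w \<Rightarrow> real"
    and u :: "real \<Rightarrow> real \<Rightarrow> 'w \<Rightarrow> real"
    and x s t :: real
  assumes "1/2 \<le> H" and "H < 3/4"
    and "fractional_white_noise M H W"
    and "mild_solution M W u"
    and "0 \<le> s" and "s \<le> t"
  shows "4 / H * prob_space.expectation M (\<lambda>\<omega>. u t x \<omega> * u s x \<omega>) =
           1 / (H * (2 * H + 1)) * (t powr (2 * H + 1) + s powr (2 * H + 1))
           - 2 / (2 * H) * t * (t - s) powr (2 * H)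
           + 2 / (2 * H + 1) * (t - s) powr (2 * H + 1)"
proof -
  interpret fractional_white_noise M H W by fact
  \<comment> \<open>Measurability is part of \<open>centred_gaussian\<close>, applied to the
    one-term combination with coefficient 1.\<close>
  have W_meas: "W f \<in> borel_measurable M" if "f \<in> wiener_integrands H" for f
    using gaussian that unfolding jointly_centred_gaussian_def
    by (elim allE[of _ "{f}"] allE[of _ "\<lambda>_. 1"]) (auto simp: centred_gaussian_def)
  have u: "u \<tau> x \<in> borel_measurable M" "AE \<omega> in M. u \<tau> x \<omega> = W (wave_integrand \<tau> x) \<omega>"
      "wave_integrand \<tau> x \<in> wiener_integrands H" if "0 \<le> \<tau>" for \<tau>
    using assms(1,4) that wave_integrand_in_wiener_integrands
    by (auto simp: mild_solution_def wave_integrand_def)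
  have t: "0 \<le> t" using assms by simp
  note [measurable] = W_meas[OF u(3)[OF t]] W_meas[OF u(3)[OF assms(5)]] u(1)[OF t] u(1)[OF assms(5)]
  have "expectation (\<lambda>\<omega>. u t x \<omega> * u s x \<omega>)
      = expectation (\<lambda>\<omega>. W (wave_integrand t x) \<omega> * W (wave_integrand s x) \<omega>)"
    using u(2)[OF t] u(2)[OF assms(5)] by (intro integral_cong_AE) auto
  also have "\<dots> = noise_cov H (wave_integrand t x) (wave_integrand s x)"
    using u(3) t assms(5) by (intro covariance)
  also note noise_cov_wave_integrand[OF assms(1,5,6)]
  finally have E: "4 / H * expectation (\<lambda>\<omega>. u t x \<omega> * u s x \<omega>) =
      ((t powr (2 * H + 1) + s powr (2 * H + 1) - (t - s) powr (2 * H + 1)) / (2 * H + 1)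
      - s * (t - s) powr (2 * H)) / H"
    by simp
  \<comment> \<open>With a single power of \<open>t - s\<close> left, writing
    \<open>s = t - (t - s)\<close> turns the term with factor \<open>s\<close> into the stated one
    with factor \<open>t\<close>; the surplus changes the coefficient of
    \<open>(t - s) powr (2 * H + 1)\<close> from \<open>- 1 / (H * (2 * H + 1))\<close> to
    \<open>2 / (2 * H + 1)\<close>.\<close>
  have d: "(t - s) powr (2 * H + 1) = (t - s) * (t - s) powr (2 * H)"
    using assms by (simp add: powr_add)
  have H: "H > 0" "2 * H + 1 > 0" using assms by auto
  show ?thesis
    unfolding E d using H by (simp add: divide_simps) (simp add: algebra_simps)
qed

end
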